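(* Let $G\leq\mathrm{GL}(d,\mathbb{R})$ be a finite group and let $v\in\mathbb{R}^d$ be such that the orbit polytope $P(G,v)$ is full-dimensional. Let $\widehat{G}=\mathrm{AGL}(P(G,v))\leq\mathrm{GL}(d,\mathbb{R})$ be its affine symmetry group. If $w\in\mathbb{R}^d$ is generic for $\widehat{G}$, then $\mathrm{AGL}(P(\widehat{G},w))=\widehat{G}$.
   Context: For a finite group $G\leq\mathrm{GL}(d,\mathbb{R})$ and $v\in\mathbb{R}^d$, the orbit polytope is $P(G,v)=\operatorname{conv}\{gv\mid g\in G\}$; it is full-dimensional if the affine hull of $Gv=\{gv\mid g\in G\}$ is $\mathbb{R}^d$. An affine symmetry of a polytope $P\subset\mathbb{R}^d$ is a bijection of $P$ that is the restriction of an affine map $\mathbb{R}^d\to\mathbb{R}^d$; $\mathrm{AGL}(P)$ is the group of affine symmetries. If $P(G,v)$ is full-dimensional, its barycenter is the origin, so each affine symmetry is the restriction of a unique element of $\mathrm{GL}(d,\mathbb{R})$, and $\mathrm{AGL}(P(G,v))$ is regarded as a (finite) subgroup of $\mathrm{GL}(d,\mathbb{R})$. For a field $K$, a finite set $I$ and a family $(v_i)_{i\in I}$ of vectors in $K^d$, put $\mathrm{LinSym}((v_i)_i)=\{\sigma\in\mathrm{Sym}(I)\mid \exists A\in\mathrm{GL}(d,K)\ \forall i\in I:\ Av_i=v_{\sigma(i)}\}$. Let $X=(X_1,\dotsc,X_d)^t$ be a vector of indeterminates, viewed as an element of $K^d$ with $K=\mathbb{R}(X_1,\dotsc,X_d)$;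 then for a finite group $H\leq\mathrm{GL}(d,\mathbb{R})$, $(hX)_{h\in H}$ is a family of vectors in $K^d$ indexed by $H$. For a finite group $H\leq\mathrm{GL}(d,\mathbb{R})$ having at least one full-dimensional orbit polytope, a point $w\in\mathbb{R}^d$ is called generic for $H$ if $P(H,w)$ is full-dimensional, $w$ has trivial stabilizer in $H$, and $\mathrm{LinSym}((hX)_{h\in H})=\mathrm{LinSym}((hw)_{h\in H})$ (the first computed over $K=\mathbb{R}(X_1,\dotsc,X_d)$, the second over $\mathbb{R}$). *)

theory Defs
  imports
    "HOL-Analysis.Analysis"
    "HOL-Algebra.Bij"
    "HOL-Library.Poly_Mapping"
    "HOL-Library.Countable"
    "HOL-Computational_Algebra.Fraction_Field"
begin

section \<open>The field of rational functions\<close>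

text \<open>
  The library shows that \<open>('x \<Rightarrow>\<^sub>0 nat) \<Rightarrow>\<^sub>0 real\<close>, the polynomial ring over the reals with
  indeterminates in \<open>'x\<close>, is an integral domain when \<open>'x\<close> is linearly ordered.  A coordinate
  type \<open>'n\<close> carries no order, so we wrap it in a type of indeterminates that has one.  The order
  is arbitrary and is used only to obtain the integral domain instance.
\<close>

datatype 'n indet = Indet (indet_index: 'n)

instantiation indet :: (countable) linorder
begin

definition less_eq_indet :: "'a indet \<Rightarrow> 'a indet \<Rightarrow> bool"
  where "x \<le> y \<longleftrightarrow> to_nat (indet_index x) \<le> to_nat (indet_index y)"

definition less_indet :: "'a indet \<Rightarrow> 'a indet \<Rightarrow> bool"
  where "x < y \<longleftrightarrow> to_nat (indet_index x) < to_nat (indet_index y)"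

instance
  by intro_classes
    (auto simp: less_eq_indet_def less_indet_def indet.expand)

end

type_synonym 'n ratfun = "(('n indet \<Rightarrow>\<^sub>0 nat) \<Rightarrow>\<^sub>0 real) fract"

definition ratfun_const :: "real \<Rightarrow> 'n::finite ratfun"
  where "ratfun_const c = Fract (Poly_Mapping.single 0 c) 1"

definition ratfun_X :: "'n::finite ratfun ^ 'n"
  where "ratfun_X = (\<chi> i. Fract (Poly_Mapping.single (Poly_Mapping.single (Indet i) 1) 1) 1)"


section \<open>Linear symmetries\<close>

definition GL :: "('a::field ^ 'n ^ 'n) monoid"
  where "GL = \<lparr>carrier = {A. invertible A}, monoid.mult = (**), one = mat 1\<rparr>"

lemma group_GL: "group (GL :: ('a::field ^ 'n ^ 'n) monoid)"
proof (rule groupI)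
  fix A :: "'a ^ 'n ^ 'n"
  assume "A \<in> carrier GL"
  then obtain B where "A ** B = mat 1" "B ** A = mat 1"
    by (auto simp: GL_def invertible_def)
  then show "\<exists>B\<in>carrier GL. B \<otimes>\<^bsub>GL\<^esub> A = \<one>\<^bsub>GL\<^esub>"
    by (auto simp: GL_def invertible_def)
qed (auto simp: GL_def invertible_mult matrix_mul_assoc invertible_def[of "mat 1"])

definition LinSym :: "'i set \<Rightarrow> ('i \<Rightarrow> 'a::field ^ 'n) \<Rightarrow> ('i \<Rightarrow> 'i) set"
  where "LinSym I v = {\<sigma>. \<sigma> permutes I \<and> (\<exists>A \<in> carrier GL. \<forall>i\<in>I. A *v v i = v (\<sigma> i))}"


section \<open>Orbit polytopes and affine symmetries\<close>

definition orbit_polytope :: "(real ^ 'n ^ 'n) set \<Rightarrow> real ^ 'n \<Rightarrow> (real ^ 'n) set"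
  where "orbit_polytope G v = convex hull ((\<lambda>g. g *v v) ` G)"

definition full_dim_orbit_polytope :: "(real ^ 'n ^ 'n) set \<Rightarrow> real ^ 'n \<Rightarrow> bool"
  where "full_dim_orbit_polytope G v \<longleftrightarrow> affine hull ((\<lambda>g. g *v v) ` G) = UNIV"

definition affine_symmetries :: "(real ^ 'n) set \<Rightarrow> (real ^ 'n \<Rightarrow> real ^ 'n) set"
  where "affine_symmetries P =
    {f \<in> Bij P. \<exists>(A :: real ^ 'n ^ 'n) b. \<forall>x\<in>P. f x = A *v x + b}"

text \<open>
  The affine symmetry group as a set of invertible matrices.  For a full-dimensional orbit polytope
  this is the whole affine symmetry group, see \<open>bij_betw_AGL_affine_symmetries\<close> below; for other
  sets it comprises only the symmetries that are restrictions of invertible linear maps.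
\<close>

definition AGL :: "(real ^ 'n) set \<Rightarrow> (real ^ 'n ^ 'n) set"
  where "AGL P = {A \<in> carrier GL. restrict ((*v) A) P \<in> affine_symmetries P}"

text \<open>
  Meant for finite subgroups \<open>H\<close> of \<open>GL\<close>.  The first conjunct entails that \<open>H\<close> has a
  full-dimensional orbit polytope.
\<close>

definition generic_for :: "(real ^ 'n ^ 'n) set \<Rightarrow> real ^ 'n \<Rightarrow> bool"
  where "generic_for H w \<longleftrightarrow>
    full_dim_orbit_polytope H w \<and>
    {h \<in> H. h *v w = w} = {mat 1} \<and>
    LinSym H (\<lambda>h. map_matrix ratfun_const h *v ratfun_X) = LinSym H (\<lambda>h. h *v w)"


section \<open>Affine symmetries of full-dimensional orbit polytopes are linear\<close>

lemma extreme_points_of_linear_image: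
  fixes f :: "'a::euclidean_space \<Rightarrow> 'b::euclidean_space"
  assumes "linear f" "inj f"
  shows "{x. x extreme_point_of f ` S} = f ` {x. x extreme_point_of S}"
  using assms
  by (auto simp: extreme_point_of_def open_segment_linear_image inj_image_mem_iff inj_eq)

context
  fixes G :: "(real ^ 'n ^ 'n) set" and v :: "real ^ 'n"
  assumes fin: "finite G" and sub: "subgroup G GL" and full: "full_dim_orbit_polytope G v"
begin

lemma GL_mult_mem: "g \<in> G \<Longrightarrow> h \<in> G \<Longrightarrow> g ** h \<in> G"
  using subgroup.m_closed[OF sub] by (auto simp: GL_def)

lemma G_image_left: assumes "h \<in> G" shows "(\<lambda>g. h ** g) ` G = G"
proof (rule endo_inj_surj[OF fin])
  show "(\<lambda>g. h ** g) ` G \<subseteq> G" using GL_mult_mem assms by auto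
  have "h \<in> carrier GL" using subgroup.subset[OF sub] assms by auto
  then obtain k where "k ** h = mat 1" by (auto simp: GL_def invertible_def)
  then show "inj_on (\<lambda>g. h ** g) G"
    by (intro inj_onI) (metis matrix_mul_assoc matrix_mul_lid)
qed

lemma G_image_right: assumes "h \<in> G" shows "(\<lambda>g. g ** h) ` G = G" "inj_on (\<lambda>g. g ** h) G"
proof -
  have "h \<in> carrier GL" using subgroup.subset[OF sub] assms by auto
  then obtain k where "h ** k = mat 1" by (auto simp: GL_def invertible_def)
  then show inj: "inj_on (\<lambda>g. g ** h) G"
    by (intro inj_onI) (metis matrix_mul_assoc matrix_mul_rid)
  show "(\<lambda>g. g ** h) ` G = G"
    by (rule endo_inj_surj[OF fin _ inj]) (use GL_mult_mem assms in auto)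
qed

lemma one_mem_G: "mat 1 \<in> G"
  using subgroup.one_closed[OF sub] by (auto simp: GL_def)

lemma fixed_point_zero:
  assumes "\<And>g. g \<in> G \<Longrightarrow> g *v u = u"
  shows "u = 0"
proof -
  define R where "R x = (\<Sum>g\<in>G. g *v x)" for x
  have lin: "linear R"
    unfolding R_def by (intro linear_compose_sum) auto
  have "R (h *v v) = R v" if "h \<in> G" for h
  proof -
    have "R (h *v v) = (\<Sum>g\<in>G. (g ** h) *v v)"
      by (simp add: R_def matrix_vector_mul_assoc)
    also have "\<dots> = (\<Sum>g\<in>(\<lambda>g. g ** h) ` G. g *v v)"
      by (subst sum.reindex) (simp_all add: G_image_right(2)[OF that])
    also have "\<dots> = R v"
      by (simp only: G_image_right(1)[OF that] R_def)
    finally show ?thesis .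
  qed
  then have "(\<lambda>g. g *v v) ` G \<subseteq> R -` {R v}" by auto
  moreover have "affine (R -` {R v})"
    using lin by (auto simp: affine_def linear_add linear_cmul simp flip: scaleR_add_left)
  ultimately have "affine hull ((\<lambda>g. g *v v) ` G) \<subseteq> R -` {R v}"
    by (rule hull_minimal)
  then have "R x = R v" for x using full by (auto simp: full_dim_orbit_polytope_def)
  then have "R u = 0" using linear_0[OF lin] by metis
  moreover have "R u = card G *\<^sub>R u"
    using assms by (simp add: R_def scaleR_conv_of_real sum_constant_scaleR del: sum_constant)
  moreover have "card G \<noteq> 0" using fin one_mem_G by auto
  ultimately show ?thesis by simp
qed

lemma orbit_polytope_image: assumes "h \<in> G"
  shows "(*v) h ` orbit_polytope G v = orbit_polytope G v"
proof -
  have "(*v) h ` (\<lambda>g. g *v v) ` G = (\<lambda>g. g *v v) ` (\<lambda>g. h ** g) ` G"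
    by (auto simp: image_image matrix_vector_mul_assoc)
  then show ?thesis
    using G_image_left[OF assms]
    by (simp add: orbit_polytope_def convex_hull_linear_image)
qed

lemma affine_hull_orbit_polytope: "affine hull (orbit_polytope G v) = UNIV"
  using full by (simp add: orbit_polytope_def full_dim_orbit_polytope_def)

lemma affine_symmetry_linear:
  fixes A :: "real ^ 'n ^ 'n"
  assumes im: "(\<lambda>x. A *v x + b) ` orbit_polytope G v = orbit_polytope G v"
  shows "invertible A" "b = 0"
proof -
  let ?P = "orbit_polytope G v"
  let ?f = "\<lambda>x. A *v x + b"
  have ext: "?f ` X = (+) b ` (*v) A ` X" for X by (auto simp: image_image add.commute)
  have "?f ` UNIV = UNIV"
    using arg_cong[OF im, of "(hull) affine"]
    by (simp add: ext affine_hull_translation affine_hull_orbit_polytope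
        flip: affine_hull_linear_image[OF matrix_vector_mul_bounded_linear])
  then have "\<exists>x. y + b = A *v x + b" for y
    using rangeE[of "y + b" ?f] by auto
  then have "surj ((*v) A)" by (simp add: surj_def)
  then show inv: "invertible A"
    by (metis invertible_right_inverse matrix_right_invertible_surjective)
  then have inj: "inj ((*v) A)"
    by (metis invertible_left_inverse matrix_left_invertible_injective)
  define E where "E = {x. x extreme_point_of ?P}"
  have "E \<subseteq> (\<lambda>g. g *v v) ` G"
    using extreme_points_of_convex_hull by (auto simp: E_def orbit_polytope_def)
  then have finE: "finite E" using fin finite_surj by blast
  have lin_E: "{x. x extreme_point_of (*v) M ` ?P} = (*v) M ` E" if "inj ((*v) M)"
    for M :: "real ^ 'n ^ 'n"
    using that by (auto simp: E_def extreme_points_of_linear_image)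
  have gE: "(*v) g ` E = E" "inj ((*v) g)" if "g \<in> G" for g
  proof -
    have "invertible g" using subgroup.subset[OF sub] that by (auto simp: GL_def)
    then show "inj ((*v) g)"
      by (metis invertible_left_inverse matrix_left_invertible_injective)
    from lin_E[OF this] show "(*v) g ` E = E"
      by (simp add: orbit_polytope_image[OF that] E_def)
  qed
  have "g *v (\<Sum>E) = \<Sum>E" if "g \<in> G" for g
  proof -
    have "g *v (\<Sum>E) = (\<Sum>e\<in>E. g *v e)"
      by (rule linear_sum[OF matrix_vector_mul_linear])
    also have "\<dots> = \<Sum>((*v) g ` E)"
      using sum.reindex[of "(*v) g" E "\<lambda>x. x"] inj_on_subset[OF gE(2)[OF that] subset_UNIV]
      by (simp add: o_def)
    also have "\<dots> = \<Sum>E" by (simp only: gE(1)[OF that])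
    finally show ?thesis .
  qed
  then have sum0: "\<Sum>E = 0" by (rule fixed_point_zero)
  have fE: "?f ` E = E"
  proof -
    have "?f ` E = {x. x extreme_point_of (+) b ` (*v) A ` ?P}"
      by (simp only: ext extreme_points_of_translation lin_E[OF inj])
    also have "\<dots> = E" using im by (simp only: ext E_def)
    finally show ?thesis .
  qed
  have "inj_on ?f E" using inj by (auto simp: inj_on_def)
  then have "\<Sum>E = (\<Sum>e\<in>E. A *v e + b)"
    using sum.reindex[of ?f E "\<lambda>x. x"] by (simp only: fE o_def)
  also have "\<dots> = (\<Sum>e\<in>E. A *v e) + card E *\<^sub>R b"
    by (simp only: sum.distrib sum_constant_scaleR)
  also have "(\<Sum>e\<in>E. A *v e) = A *v (\<Sum>E)"
    by (rule linear_sum[OF matrix_vector_mul_linear, symmetric])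
  finally have "card E *\<^sub>R b = 0" using sum0 by simp
  moreover have "E \<noteq> {}"
  proof
    assume "E = {}"
    then have "?P = {}"
      using Krein_Milman_polytope[of "(\<lambda>g. g *v v) ` G"] fin
      by (simp add: E_def orbit_polytope_def)
    then show False using affine_hull_orbit_polytope by simp
  qed
  ultimately show "b = 0" using finE by simp
qed

lemma bij_betw_AGL_affine_symmetries:
  "bij_betw (\<lambda>A. restrict ((*v) A) (orbit_polytope G v))
     (AGL (orbit_polytope G v)) (affine_symmetries (orbit_polytope G v))"
proof (rule bij_betwI')
  let ?P = "orbit_polytope G v"
  fix A B :: "real ^ 'n ^ 'n"
  show "restrict ((*v) A) ?P = restrict ((*v) B) ?P \<longleftrightarrow> A = B"
  proof
    assume eq: "restrict ((*v) A) ?P = restrict ((*v) B) ?P"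
    have "?P \<subseteq> {x. (A - B) *v x = 0}"
      using eq by (auto simp: matrix_vector_mult_diff_rdistrib) (metis restrict_apply')
    moreover have "affine {x. (A - B) *v x = 0}"
      by (simp add: subspace_imp_affine linear_subspace_kernel)
    ultimately have "(A - B) *v x = 0" for x
      using hull_minimal[of ?P] affine_hull_orbit_polytope by blast
    then show "A = B"
      by (simp add: matrix_eq matrix_vector_mult_diff_rdistrib)
  qed simp
next
  fix A assume "A \<in> AGL (orbit_polytope G v)"
  then show "restrict ((*v) A) (orbit_polytope G v) \<in> affine_symmetries (orbit_polytope G v)"
    by (simp add: AGL_def)
next
  let ?P = "orbit_polytope G v"
  fix f assume f: "f \<in> affine_symmetries ?P"
  then obtain A :: "real ^ 'n ^ 'n" and b where A: "\<And>x. x \<in> ?P \<Longrightarrow> f x = A *v x + b"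
    by (auto simp: affine_symmetries_def)
  have "f ` ?P = ?P" using f by (simp add: affine_symmetries_def Bij_def bij_betw_def)
  then have "(\<lambda>x. A *v x + b) ` ?P = ?P" using A by simp
  note lin = affine_symmetry_linear[OF this]
  have "f = restrict ((*v) A) ?P"
    using f A lin(2) by (intro extensionalityI[of f ?P]) (auto simp: affine_symmetries_def Bij_def)
  then show "\<exists>A \<in> AGL ?P. f = restrict ((*v) A) ?P"
    using f lin(1) by (intro bexI[of _ A]) (auto simp: AGL_def GL_def)
qed

end

end

theory Submission
  imports Defs "HOL-Combinatorics.Cycles"
begin

text \<open>
  Let \<open>H\<close> be the affine symmetry group of \<open>P(G, v)\<close>.  A symmetry \<open>A\<close> of \<open>P(H, w)\<close> permutes the
  vertices \<open>h w\<close>, hence induces a permutation \<open>\<sigma>\<close> of \<open>H\<close>, which by genericity is a linear symmetry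
  of \<open>(h X)\<^sub>h\<close>.  Such a symmetry specialises to every \<open>u\<close> whose orbit spans: there is a matrix
  \<open>A\<^sub>u\<close> with \<open>A\<^sub>u h u = \<sigma>(h) u\<close>.  At \<open>u = v\<close> it preserves \<open>P(G, v) = P(H, v)\<close>, so \<open>A\<^sub>v = k \<in> H\<close>.
  The matrices \<open>k\<^sup>-\<^sup>1 A\<^sub>u\<close> have bounded finite order and equal the identity at \<open>u = v\<close>, hence also for \<open>u\<close>
  near \<open>v\<close>.  Therefore \<open>\<sigma>(h) = k h\<close> for all \<open>h\<close>, and \<open>A = k\<close>.
\<close>

section \<open>Evaluation of polynomials\<close>

definition monom_eval :: "('n::finite indet \<Rightarrow>\<^sub>0 nat) \<Rightarrow> real ^ 'n \<Rightarrow> real"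
  where "monom_eval m u = (\<Prod>i\<in>UNIV. u $ i ^ Poly_Mapping.lookup m (Indet i))"

definition poly_eval :: "(('n::finite indet \<Rightarrow>\<^sub>0 nat) \<Rightarrow>\<^sub>0 real) \<Rightarrow> real ^ 'n \<Rightarrow> real"
  where "poly_eval p u = (\<Sum>m\<in>Poly_Mapping.keys p. Poly_Mapping.lookup p m * monom_eval m u)"

lemma monom_eval_add: "monom_eval (m + m') u = monom_eval m u * monom_eval m' u"
  by (simp add: monom_eval_def Poly_Mapping.lookup_add power_add prod.distrib)

lemma monom_eval_indet [simp]: "monom_eval (Poly_Mapping.single (Indet i) 1) u = u $ i"
proof -
  have "monom_eval (Poly_Mapping.single (Indet i) 1) u = (\<Prod>j\<in>UNIV. if j = i then u $ j else 1)"
    unfolding monom_eval_def by (intro prod.cong) (auto simp: Poly_Mapping.lookup_single when_def)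
  then show ?thesis by simp
qed

lemma poly_eval_0 [simp]: "poly_eval 0 u = 0"
  by (simp add: poly_eval_def)

lemma poly_eval_single [simp]: "poly_eval (Poly_Mapping.single m c) u = c * monom_eval m u"
  by (cases "c = 0") (auto simp: poly_eval_def)

lemma poly_eval_add [simp]: "poly_eval (p + q) u = poly_eval p u + poly_eval q u"
  unfolding poly_eval_def
  by (rule setsum_keys_plus_distrib) (auto simp: distrib_right)

lemma poly_eval_sum [simp]: "poly_eval (\<Sum>i\<in>I. p i) u = (\<Sum>i\<in>I. poly_eval (p i) u)"
  by (induction I rule: infinite_finite_induct) auto

lemma poly_mapping_sum_single:
  "p = (\<Sum>m\<in>Poly_Mapping.keys p. Poly_Mapping.single m (Poly_Mapping.lookup p m))"
  by (rule poly_mapping_eqI)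
    (auto simp: Poly_Mapping.lookup_sum Poly_Mapping.lookup_single when_def Poly_Mapping.in_keys_iff)

lemma poly_eval_mult [simp]: "poly_eval (p * q) u = poly_eval p u * poly_eval q u"
proof -
  have "p * q = (\<Sum>m\<in>Poly_Mapping.keys p. \<Sum>m'\<in>Poly_Mapping.keys q.
      Poly_Mapping.single (m + m') (Poly_Mapping.lookup p m * Poly_Mapping.lookup q m'))"
    by (subst poly_mapping_sum_single[of p], subst poly_mapping_sum_single[of q])
      (simp add: sum_product mult_single)
  then have "poly_eval (p * q) u = (\<Sum>m\<in>Poly_Mapping.keys p. \<Sum>m'\<in>Poly_Mapping.keys q.
      Poly_Mapping.lookup p m * Poly_Mapping.lookup q m' * (monom_eval m u * monom_eval m' u))"
    by (simp only: poly_eval_sum poly_eval_single monom_eval_add)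
  then show ?thesis
    by (simp add: poly_eval_def sum_product mult_ac)
qed

section \<open>Density of the nonvanishing set of a nonzero polynomial\<close>

text \<open>Finitely many hyperplanes form a null set and cannot cover the space. Applied to
  differences of exponent vectors, this gives a direction that separates the monomials of a
  polynomial.\<close>

lemma exists_nonorthogonal:
  fixes D :: "'a::euclidean_space set"
  assumes "finite D" "0 \<notin> D"
  shows "\<exists>a. \<forall>d\<in>D. d \<bullet> a \<noteq> 0"
proof -
  have "negligible (\<Union>d\<in>D. {x. d \<bullet> x = 0})"
    using assms by (intro negligible_Union) (auto intro!: negligible_hyperplane)
  then have "(\<Union>d\<in>D. {x. d \<bullet> x = 0}) \<noteq> UNIV"
    using non_negligible_UNIV by metis
  then show ?thesis by blast
qed

text \<open>
  On the points \<open>(exp (k a\<^sub>i))\<^sub>i\<close> the monomial \<open>m\<close> takes the value \<open>(exp (m \<bullet> a)) ^ k\<close>; for suitable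
  \<open>a\<close> these bases are distinct, so interpolation in the base isolates a single coefficient.
\<close>

lemma poly_eval_nonzero:
  fixes p :: "('n::finite indet \<Rightarrow>\<^sub>0 nat) \<Rightarrow>\<^sub>0 real"
  assumes "p \<noteq> 0"
  shows "\<exists>u. poly_eval p u \<noteq> 0"
proof (rule ccontr)
  assume "\<not> ?thesis"
  then have zero: "poly_eval p u = 0" for u by auto
  define e :: "('n indet \<Rightarrow>\<^sub>0 nat) \<Rightarrow> real ^ 'n" where "e m = (\<chi> i. real (Poly_Mapping.lookup m (Indet i)))" for m
  have inj_e: "m = m'" if "e m = e m'" for m m'
  proof (rule poly_mapping_eqI)
    fix x show "Poly_Mapping.lookup m x = Poly_Mapping.lookup m' x"
      using that by (cases x) (simp add: e_def vec_eq_iff)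
  qed
  define D where "D = {e m - e m' |m m'. m \<in> Poly_Mapping.keys p \<and> m' \<in> Poly_Mapping.keys p \<and> m \<noteq> m'}"
  have finD: "finite D"
    by (rule finite_subset[of _ "(\<lambda>(m, m'). e m - e m') ` (Poly_Mapping.keys p \<times> Poly_Mapping.keys p)"]) (auto simp: D_def)
  have zeroD: "0 \<notin> D" using inj_e by (auto simp: D_def)
  obtain a where a: "\<And>d. d \<in> D \<Longrightarrow> d \<bullet> a \<noteq> 0"
    using exists_nonorthogonal[OF finD zeroD] by blast
  define l where "l m = exp (e m \<bullet> a)" for m
  have inj_l: "l m \<noteq> l m'" if "m \<in> Poly_Mapping.keys p" "m' \<in> Poly_Mapping.keys p" "m \<noteq> m'" for m m'
  proof -
    have "e m - e m' \<in> D" using that by (auto simp: D_def)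
    from a[OF this] show ?thesis by (simp add: l_def inner_diff_left)
  qed
  have "monom_eval m (\<chi> i. exp (a $ i) ^ k) = l m ^ k" for m k
  proof -
    have "monom_eval m (\<chi> i. exp (a $ i) ^ k) = (\<Prod>i\<in>UNIV. exp (real (Poly_Mapping.lookup m (Indet i)) * a $ i) ^ k)"
      unfolding monom_eval_def
      by (intro prod.cong) (auto simp: exp_of_nat_mult[symmetric] mult_ac)
    also have "\<dots> = l m ^ k"
      by (simp add: l_def e_def inner_vec_def exp_sum prod_power_distrib)
    finally show ?thesis .
  qed
  then have pow: "(\<Sum>m\<in>Poly_Mapping.keys p. Poly_Mapping.lookup p m * l m ^ k) = 0" for k
    using zero[of "\<chi> i. exp (a $ i) ^ k"] by (simp add: poly_eval_def)
  \<comment> \<open>Linear combinations of the relations \<open>pow\<close> allow any univariate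
    polynomial in \<open>l m\<close> in place of the power \<open>l m ^ k\<close>.\<close>
  have all: "(\<Sum>m\<in>Poly_Mapping.keys p. Poly_Mapping.lookup p m * poly P (l m)) = 0" for P
  proof -
    have "(\<Sum>m\<in>Poly_Mapping.keys p. Poly_Mapping.lookup p m * poly P (l m))
        = (\<Sum>m\<in>Poly_Mapping.keys p. \<Sum>k\<le>degree P. coeff P k * (Poly_Mapping.lookup p m * l m ^ k))"
      by (simp add: poly_altdef sum_distrib_left mult_ac)
    also have "\<dots> = (\<Sum>k\<le>degree P. coeff P k * (\<Sum>m\<in>Poly_Mapping.keys p. Poly_Mapping.lookup p m * l m ^ k))"
      by (subst sum.swap) (simp add: sum_distrib_left)
    finally show ?thesis by (simp add: pow)
  qed
  obtain m where m: "m \<in> Poly_Mapping.keys p" using assms by (meson ex_in_conv keys_eq_empty)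
  define P where "P = (\<Prod>m'\<in>Poly_Mapping.keys p - {m}. [:- l m', 1:])"
  have "poly P (l m') = 0" if "m' \<in> Poly_Mapping.keys p - {m}" for m'
    using that by (auto simp: P_def poly_prod intro!: prod_zero)
  then have "(\<Sum>m\<in>Poly_Mapping.keys p. Poly_Mapping.lookup p m * poly P (l m)) = Poly_Mapping.lookup p m * poly P (l m)"
    by (subst sum.remove[OF finite_keys m]) simp
  moreover have "poly P (l m) \<noteq> 0"
    using inj_l m by (auto simp: P_def poly_prod)
  ultimately show False using all m by (simp add: Poly_Mapping.in_keys_iff)
qed

text \<open>Join an arbitrary point \<open>v\<close> to a point \<open>z\<close> with
  \<open>poly_eval p z\<close> nonzero. Along this line \<open>p\<close> becomes a nonzero
  univariate polynomial, so points of the line where \<open>p\<close> does not vanish come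
  arbitrarily close to \<open>v\<close>.\<close>

lemma closure_poly_eval_nonzero:
  fixes p :: "('n::finite indet \<Rightarrow>\<^sub>0 nat) \<Rightarrow>\<^sub>0 real"
  assumes "p \<noteq> 0"
  shows "closure {u. poly_eval p u \<noteq> 0} = UNIV"
proof -
  obtain z where z: "poly_eval p z \<noteq> 0" using poly_eval_nonzero[OF assms] by auto
  have "v \<in> closure {u. poly_eval p u \<noteq> 0}" for v
  proof -
    define line where "line t = v + t *\<^sub>R (z - v)" for t :: real
    define P where "P = (\<Sum>m\<in>Poly_Mapping.keys p. smult (Poly_Mapping.lookup p m)
        (\<Prod>i\<in>UNIV. [:v $ i, z $ i - v $ i:] ^ Poly_Mapping.lookup m (Indet i)))"
    have P: "poly P t = poly_eval p (line t)" for t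
      by (simp add: P_def poly_eval_def monom_eval_def line_def poly_sum poly_prod)
    have "poly P 1 \<noteq> 0" using z by (simp add: P line_def)
    then have "finite {t. poly P t = 0}" by (intro poly_roots_finite) auto
    \<comment> \<open>The finitely many roots cannot accumulate at 0, but the real line does; hence
      the nonroots do.\<close>
    then have "\<not> 0 islimpt {t. poly P t = 0}" by (rule islimpt_finite)
    moreover have "(0::real) islimpt ({t. poly P t = 0} \<union> {t. poly P t \<noteq> 0})"
    proof -
      have "{t. poly P t = 0} \<union> {t. poly P t \<noteq> 0} = UNIV" by auto
      then show ?thesis by (simp add: islimpt_UNIV)
    qed
    ultimately have "0 \<in> closure {t. poly P t \<noteq> 0}"
      by (simp add: islimpt_Un closure_def)
    then have "line 0 \<in> line ` closure {t. poly P t \<noteq> 0}" by blast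
    also have "\<dots> \<subseteq> closure (line ` {t. poly P t \<noteq> 0})"
      by (rule image_closure_subset)
        (auto simp: line_def intro!: continuous_intros closure_subset[THEN subsetD])
    also have "\<dots> \<subseteq> closure {u. poly_eval p u \<noteq> 0}"
      by (rule closure_mono) (auto simp: P)
    finally show ?thesis by (simp add: line_def)
  qed
  then show ?thesis by auto
qed


section \<open>Clearing denominators\<close>

lemma common_denominator:
  fixes f :: "'i \<Rightarrow> 'a::idom fract"
  assumes "finite S"
  shows "\<exists>q. q \<noteq> 0 \<and> (\<forall>x\<in>S. \<exists>p. Fract q 1 * f x = Fract p 1)"
  using assms
proof (induction S)
  case empty
  then show ?case by (auto intro: exI[of _ 1])
next
  case (insert x S)
  then obtain q where q: "q \<noteq> 0" "\<forall>y\<in>S. \<exists>p. Fract q 1 * f y = Fract p 1" by auto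
  obtain a b where ab: "f x = Fract a b" "b \<noteq> 0" by (cases "f x")
  show ?case
  proof (rule exI[of _ "b * q"], intro conjI ballI)
    show "b * q \<noteq> 0" using q ab by simp
    fix y assume "y \<in> insert x S"
    then consider "y = x" | "y \<in> S" by auto
    then show "\<exists>p. Fract (b * q) 1 * f y = Fract p 1"
    proof cases
      case 1
      then show ?thesis using ab by (intro exI[of _ "q * a"]) (simp add: eq_fract)
    next
      case 2
      then obtain p where "Fract q 1 * f y = Fract p 1" using q by auto
      moreover have "Fract (b * q) 1 = Fract b 1 * Fract q 1" by simp
      ultimately have "Fract (b * q) 1 * f y = Fract (b * p) 1"
        by (simp only: mult.assoc) simp
      then show ?thesis by blast
    qed
  qed
qed

lemma Fract_1_sum: "(\<Sum>i\<in>I. Fract (f i) 1) = Fract (\<Sum>i\<in>I. f i) (1::'a::idom)"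
  by (induction I rule: infinite_finite_induct) (auto simp: Zero_fract_def)

definition linear_form :: "real ^ 'n \<Rightarrow> ('n::finite indet \<Rightarrow>\<^sub>0 nat) \<Rightarrow>\<^sub>0 real"
  where "linear_form a = (\<Sum>j\<in>UNIV. Poly_Mapping.single (Poly_Mapping.single (Indet j) 1) (a $ j))"

lemma poly_eval_linear_form: "poly_eval (linear_form a) u = (\<Sum>j\<in>UNIV. a $ j * u $ j)"
  by (simp add: linear_form_def del: One_nat_def)

text \<open>The coordinates of \<open>h X\<close> are themselves polynomials, so in an equation
  \<open>B (h X) = \<sigma>(h) X\<close> only the entries of \<open>B\<close> carry
  denominators.\<close>

lemma ratfun_matrix_vector_nth:
  "(map_matrix ratfun_const h *v ratfun_X) $ i = Fract (linear_form (h $ i)) 1"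
  by (simp add: matrix_vector_mult_def ratfun_const_def ratfun_X_def linear_form_def mult_single
      Fract_1_sum)

text \<open>Multiplying the generic equation by a common denominator \<open>q\<close> of the matrix
  entries yields polynomial identities. They can be evaluated at real points, and divided by the
  value of \<open>q\<close> wherever it is nonzero, which is on a dense set.\<close>

lemma ratfun_LinSym_dense:
  fixes H :: "(real ^ 'n ^ 'n) set"
  assumes "\<sigma> \<in> LinSym H (\<lambda>h. map_matrix ratfun_const h *v ratfun_X)"
  obtains U where "closure U = UNIV" "\<And>u. u \<in> U \<Longrightarrow> \<exists>A. \<forall>h\<in>H. A *v (h *v u) = \<sigma> h *v u"
proof -
  let ?X = "\<lambda>h. map_matrix ratfun_const h *v (ratfun_X :: 'n ratfun ^ 'n)"
  obtain B where B: "\<And>h. h \<in> H \<Longrightarrow> B *v ?X h = ?X (\<sigma> h)"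
    using assms by (auto simp: LinSym_def)
  obtain q where q: "q \<noteq> 0" "\<forall>(i, j) \<in> UNIV. \<exists>p. Fract q 1 * B $ i $ j = Fract p 1"
    using common_denominator[of "UNIV :: ('n \<times> 'n) set" "\<lambda>(i, j). B $ i $ j"] by auto
  then have "\<forall>i j. \<exists>p. Fract q 1 * B $ i $ j = Fract p 1" by auto
  then obtain P where P: "\<And>i j. Fract q 1 * B $ i $ j = Fract (P i j) 1" by metis
  \<comment> \<open>This is coordinate \<open>i\<close> of the generic equation, multiplied by
    \<open>q\<close>.\<close>
  have id: "(\<Sum>j\<in>UNIV. P i j * linear_form (h $ j)) = q * linear_form (\<sigma> h $ i)"
    if "h \<in> H" for h i
  proof -
    have "Fract (\<Sum>j\<in>UNIV. P i j * linear_form (h $ j)) 1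
        = (\<Sum>j\<in>UNIV. Fract (P i j) 1 * Fract (linear_form (h $ j)) 1)"
      by (simp add: Fract_1_sum)
    also have "\<dots> = Fract q 1 * (B *v ?X h) $ i"
      by (simp add: matrix_vector_mult_def[of B] ratfun_matrix_vector_nth sum_distrib_left
          mult.assoc flip: P del: mult_fract)
    also have "\<dots> = Fract (q * linear_form (\<sigma> h $ i)) 1"
      by (simp only: B[OF that] ratfun_matrix_vector_nth) simp
    finally show ?thesis by (simp add: eq_fract)
  qed
  show thesis
  proof (rule that)
    show "closure {u. poly_eval q u \<noteq> 0} = UNIV" by (rule closure_poly_eval_nonzero[OF q(1)])
    fix u assume "u \<in> {u. poly_eval q u \<noteq> 0}"
    then have qu: "poly_eval q u \<noteq> 0" by simp
    define A where "A = (\<chi> i j. poly_eval (P i j) u / poly_eval q u)"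
    have "A *v (h *v u) = \<sigma> h *v u" if "h \<in> H" for h
    proof (rule vec_eq_iff[THEN iffD2], rule allI)
      fix i
      have "poly_eval q u * (A *v (h *v u)) $ i
          = (\<Sum>j\<in>UNIV. poly_eval (P i j) u * (\<Sum>k\<in>UNIV. h $ j $ k * u $ k))"
        using qu by (simp add: A_def matrix_vector_mult_def sum_distrib_left)
      also have "\<dots> = poly_eval q u * (\<sigma> h *v u) $ i"
        using arg_cong[OF id[OF that, of i], of "\<lambda>p. poly_eval p u"]
        by (simp add: poly_eval_linear_form matrix_vector_mult_def)
      finally show "(A *v (h *v u)) $ i = (\<sigma> h *v u) $ i" using qu by simp
    qed
    then show "\<exists>A. \<forall>h\<in>H. A *v (h *v u) = \<sigma> h *v u" by blast
  qed
qed


section \<open>Gram matrices\<close>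

lemma continuous_on_det [continuous_intros]:
  fixes f :: "'a::topological_space \<Rightarrow> real ^ 'n ^ 'n"
  assumes "\<And>i j. continuous_on S (\<lambda>x. f x $ i $ j)"
  shows "continuous_on S (\<lambda>x. det (f x))"
  unfolding det_def by (intro continuous_intros assms)

text \<open>With the vectors \<open>x i\<close> and \<open>y i\<close> as columns of matrices X and
  Y, this is the product of X with the transpose of Y.\<close>

definition gram :: "'i set \<Rightarrow> ('i \<Rightarrow> real ^ 'n) \<Rightarrow> ('i \<Rightarrow> real ^ 'n) \<Rightarrow> real ^ 'n ^ 'n"
  where "gram I x y = (\<chi> a b. \<Sum>i\<in>I. x i $ a * y i $ b)"

lemma gram_mult: "gram I x y *v z = (\<Sum>i\<in>I. (y i \<bullet> z) *\<^sub>R x i)"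
  by (simp add: vec_eq_iff gram_def matrix_vector_mult_def inner_vec_def sum_distrib_left
      sum_distrib_right mult_ac) (intro allI sum.swap)

text \<open>For \<open>x = y\<close> this exhibits row \<open>a\<close> of \<open>A\<close> as a
  solution of a linear system whose data involve \<open>A\<close> only through the images
  \<open>A *v y i\<close>. Cramer's rule can then recover \<open>A\<close> from the images.\<close>

lemma matrix_mult_gram: "gram I x y *v A $ a = (\<chi> b. \<Sum>i\<in>I. (A *v y i) $ a * x i $ b)"
  by (simp add: gram_mult vec_eq_iff matrix_vector_mult_def[of A] inner_vec_def mult_ac)

text \<open>The range of the Gram matrix lies in the span of the family. Conversely, a kernel vector
  \<open>z\<close> satisfies \<Sum> (x i \<bullet> z)^2 = 0, so it is orthogonal to the whole
  family.\<close>

lemma det_gram_nonzero_iff: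
  assumes "finite I"
  shows "det (gram I x x) \<noteq> 0 \<longleftrightarrow> span (x ` I) = UNIV"
proof
  assume "det (gram I x x) \<noteq> 0"
  then have "surj ((*v) (gram I x x))"
    by (metis invertible_det_nz invertible_right_inverse matrix_right_invertible_surjective)
  moreover have "gram I x x *v z \<in> span (x ` I)" for z
    by (simp add: gram_mult span_sum span_scale span_base)
  ultimately show "span (x ` I) = UNIV" by (metis UNIV_eq_I surj_def)
next
  assume span: "span (x ` I) = UNIV"
  have "z = 0" if "gram I x x *v z = 0" for z
  proof -
    have "(\<Sum>i\<in>I. (x i \<bullet> z)\<^sup>2) = (gram I x x *v z) \<bullet> z"
      by (simp add: gram_mult inner_sum_left power2_eq_square)
    then have "\<forall>i\<in>I. x i \<bullet> z = 0"
      using that assms by (simp add: sum_nonneg_eq_0_iff)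
    then have "orthogonal z y" if "y \<in> x ` I" for y
      using that by (auto simp: orthogonal_def inner_commute)
    then have "orthogonal z z"
      using span by (intro orthogonal_to_span[of z "x ` I"]) auto
    then show "z = 0" by (simp add: orthogonal_def)
  qed
  then show "det (gram I x x) \<noteq> 0"
    by (metis invertible_det_nz invertible_left_inverse matrix_left_invertible_ker)
qed

text \<open>Spanning is the nonvanishing of the Gram determinant, a continuous function of
  \<open>u\<close>.\<close>

lemma open_spanning:
  fixes f :: "'i \<Rightarrow> 'a::topological_space \<Rightarrow> real ^ 'n"
  assumes "finite I" "\<And>i. i \<in> I \<Longrightarrow> continuous_on UNIV (f i)"
  shows "open {u. span ((\<lambda>i. f i u) ` I) = UNIV}"
proof -
  have "open {u. det (gram I (\<lambda>i. f i u) (\<lambda>i. f i u)) \<noteq> 0}"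
    by (intro open_Collect_neq) (auto simp: gram_def intro!: continuous_intros assms(2))
  then show ?thesis using assms(1) by (simp add: det_gram_nonzero_iff)
qed

lemma matrix_eq_on_spanning:
  fixes A B :: "real ^ 'n ^ 'm"
  assumes "span S = UNIV" "\<And>x. x \<in> S \<Longrightarrow> A *v x = B *v x"
  shows "A = B"
  using linear_eq_on_span[of "(*v) A" "(*v) B" S] assms by (simp add: matrix_eq)

lemma invertible_if_spanning_image:
  fixes A :: "real ^ 'n ^ 'n"
  assumes "span ((*v) A ` S) = UNIV"
  shows "invertible A"
proof -
  have "surj ((*v) A)"
    using assms by (metis linear_span_image matrix_vector_mul_linear image_mono subset_UNIV top.extremum_uniqueI)
  then show ?thesis
    by (metis invertible_right_inverse matrix_right_invertible_surjective)
qed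


section \<open>Specialisation of generic linear symmetries\<close>

text \<open>
  The generic matrix is only known to specialise where its denominators do not vanish.  Cramer's
  rule for the Gram system yields the adjugate form \<open>C u (h u) = det (T u) (\<sigma> h u)\<close>,
  which extends to all \<open>u\<close> by continuity.
\<close>

lemma ratfun_LinSym_specialise:
  fixes H :: "(real ^ 'n ^ 'n) set"
  assumes fin: "finite H"
    and \<sigma>: "\<sigma> \<in> LinSym H (\<lambda>h. map_matrix ratfun_const h *v ratfun_X)"
    and span: "span ((\<lambda>h. h *v u) ` H) = UNIV"
  shows "\<sigma> \<in> LinSym H (\<lambda>h. h *v u)"
proof -
  obtain U where U: "closure U = UNIV"
      "\<And>u. u \<in> U \<Longrightarrow> \<exists>A. \<forall>h\<in>H. A *v (h *v u) = \<sigma> h *v u"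
    using ratfun_LinSym_dense[OF \<sigma>] by metis
  define T where "T x = gram H (\<lambda>h. h *v x) (\<lambda>h. h *v x)" for x
  define S where "S x = gram H (\<lambda>h. \<sigma> h *v x) (\<lambda>h. h *v x)" for x
  \<comment> \<open>Entry (\<open>a\<close>, \<open>k\<close>) is the Cramer numerator: the
    determinant of \<open>T x\<close> with column \<open>k\<close> replaced by row \<open>a\<close>
    of \<open>S x\<close>.\<close>
  define C :: "real ^ 'n \<Rightarrow> real ^ 'n ^ 'n"
    where "C x = (\<chi> a k. det (\<chi> i j. if j = k then S x $ a $ i else T x $ i $ j))" for x
  have cont: "continuous_on UNIV (\<lambda>x. S x $ i $ j)" "continuous_on UNIV (\<lambda>x. T x $ i $ j)" for i j
    by (auto simp: S_def T_def gram_def intro!: continuous_intros)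
  have contC: "continuous_on UNIV (\<lambda>x. C x $ a $ k)" for a k
  proof -
    have "continuous_on UNIV (\<lambda>x. if j = k then S x $ a $ i else T x $ i $ j)" for i j
      by (cases "j = k") (simp_all add: cont)
    then show ?thesis
      unfolding C_def vec_lambda_beta by (intro continuous_on_det) simp
  qed
  have "C x *v (h *v x) = det (T x) *\<^sub>R (\<sigma> h *v x)" if "x \<in> U" "h \<in> H" for x h
  proof -
    obtain A where A: "\<And>h. h \<in> H \<Longrightarrow> A *v (h *v x) = \<sigma> h *v x" using U(2)[OF \<open>x \<in> U\<close>] by auto
    have TA: "T x *v A $ a = S x $ a" for a
      by (simp add: T_def S_def matrix_mult_gram A) (simp add: gram_def vec_eq_iff)
    then have "C x $ a $ k = (det (T x) *\<^sub>R A) $ a $ k" for a k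
      using cramer_lemma[of k "T x" "A $ a"] unfolding TA by (simp add: C_def mult.commute)
    then have "C x = det (T x) *\<^sub>R A" by (simp add: vec_eq_iff)
    then show ?thesis using A[OF \<open>h \<in> H\<close>] by (simp add: scaleR_matrix_vector_assoc[symmetric])
  qed
  then have "U \<subseteq> {x. (C x *v (h *v x)) $ i = det (T x) * (\<sigma> h *v x) $ i}" if "h \<in> H" for h i
    using that by auto
  moreover have "closed {x. (C x *v (h *v x)) $ i = det (T x) * (\<sigma> h *v x) $ i}" for h i
  proof (rule closed_Collect_eq)
    show "continuous_on UNIV (\<lambda>x. (C x *v (h *v x)) $ i)"
      unfolding matrix_vector_mult_def[of "C _"] vec_lambda_beta
      by (intro continuous_intros contC)
    show "continuous_on UNIV (\<lambda>x. det (T x) * (\<sigma> h *v x) $ i)"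
      by (intro continuous_intros cont)
  qed
  ultimately have "UNIV \<subseteq> {x. (C x *v (h *v x)) $ i = det (T x) * (\<sigma> h *v x) $ i}" if "h \<in> H" for h i
    unfolding U(1)[symmetric] using that by (intro closure_minimal) blast+
  then have C: "C u *v (h *v u) = det (T u) *\<^sub>R (\<sigma> h *v u)" if "h \<in> H" for h
    using that by (auto simp: vec_eq_iff)
  have "det (T u) \<noteq> 0" using span fin by (simp add: T_def det_gram_nonzero_iff)
  define A where "A = (1 / det (T u)) *\<^sub>R C u"
  have A: "A *v (h *v u) = \<sigma> h *v u" if "h \<in> H" for h
    using C[OF that] \<open>det (T u) \<noteq> 0\<close> by (simp add: A_def scaleR_matrix_vector_assoc[symmetric])
  have perm: "\<sigma> permutes H" using \<sigma> by (simp add: LinSym_def)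
  \<comment> \<open>As \<sigma> permutes \<open>H\<close>, the matrix maps the spanning orbit onto
    itself, which forces invertibility.\<close>
  have "(*v) A ` (\<lambda>h. h *v u) ` H = (\<lambda>h. h *v u) ` \<sigma> ` H"
    using A by (auto simp: image_image)
  then have "invertible A"
    using span permutes_image[OF perm] invertible_if_spanning_image by metis
  then show ?thesis using A perm by (auto simp: LinSym_def GL_def)
qed

text \<open>
  The vectors \<open>y h u = (\<Sum>j<m. (\<tau> ^^ j) h *v u)\<close>, with \<open>\<tau> ^^ m = id\<close>, are fixed by the matrix
  inducing \<open>\<tau>\<close> on the orbit of \<open>u\<close>.  They span for \<open>u = v\<close>, hence for all \<open>u\<close> near \<open>v\<close>.
\<close>

lemma LinSym_rigid:
  fixes H :: "(real ^ 'n ^ 'n) set"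
  assumes fin: "finite H" and perm: "\<tau> permutes H"
    and span: "span ((\<lambda>h. h *v v) ` H) = UNIV"
    and fix_v: "\<And>h. h \<in> H \<Longrightarrow> \<tau> h *v v = h *v v"
    and ind: "\<And>u. span ((\<lambda>h. h *v u) ` H) = UNIV \<Longrightarrow> \<exists>A. \<forall>h\<in>H. A *v (h *v u) = \<tau> h *v u"
    and "h \<in> H"
  shows "\<tau> h = h"
proof -
  obtain m where m: "\<tau> ^^ m = id" "m > 0"
    using permutation_is_nilpotent permutes_imp_permutation[OF fin perm] by blast
  have iter: "(\<tau> ^^ j) h \<in> H" if "h \<in> H" for j h
    using that permutes_in_image[OF perm] by (induction j) auto
  define y where "y h u = (\<Sum>j<m. (\<tau> ^^ j) h *v u)" for h u
  define U where "U = {u. span ((\<lambda>h. y h u) ` H) = UNIV}"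
  have "open U"
    unfolding U_def y_def by (intro open_spanning[OF fin] continuous_intros)
  have "v \<in> U"
  proof -
    have "(\<tau> ^^ j) h *v v = h *v v" if "h \<in> H" for j h
      using fix_v iter[OF that] by (induction j) auto
    then have "y h v = real m *\<^sub>R (h *v v)" if "h \<in> H" for h
      using that by (simp add: y_def sum_constant_scaleR del: sum_constant)
    then have "h *v v \<in> span ((\<lambda>h. y h v) ` H)" if "h \<in> H" for h
      using that m(2) span_scale[OF span_base[of "y h v" "(\<lambda>h. y h v) ` H"], of "1 / real m"] by auto
    then have "span ((\<lambda>h. h *v v) ` H) \<subseteq> span ((\<lambda>h. y h v) ` H)"
      by (intro span_minimal) auto
    then show ?thesis using span by (auto simp: U_def)
  qed
  have "(\<tau> h - h) *v u = 0" if "u \<in> U" for u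
  proof -
    \<comment> \<open>For \<open>u\<close> in \<open>U\<close> the orbit of \<open>u\<close> spans
      too, so \<open>ind\<close> supplies a matrix at \<open>u\<close>.\<close>
    have "y h u \<in> span ((\<lambda>h. h *v u) ` H)" if "h \<in> H" for h
      unfolding y_def using iter[OF that] by (intro span_sum span_base) auto
    then have "span ((\<lambda>h. y h u) ` H) \<subseteq> span ((\<lambda>h. h *v u) ` H)"
      by (intro span_minimal) auto
    then have "span ((\<lambda>h. h *v u) ` H) = UNIV" using that by (auto simp: U_def)
    from ind[OF this] obtain A where A: "\<And>h. h \<in> H \<Longrightarrow> A *v (h *v u) = \<tau> h *v u" by auto
    \<comment> \<open>\<open>A\<close> shifts the summands of \<open>y h u\<close> cyclically,
      because \<open>\<tau> ^^ m = id\<close>. It thus fixes a spanning set and is the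
      identity.\<close>
    have "A *v y h u = y h u" if "h \<in> H" for h
    proof -
      have "A *v y h u = (\<Sum>j<m. A *v ((\<tau> ^^ j) h *v u))"
        unfolding y_def by (rule linear_sum[OF matrix_vector_mul_linear])
      also have "\<dots> = (\<Sum>j<m. (\<tau> ^^ Suc j) h *v u)"
        by (intro sum.cong) (auto simp: A iter that)
      also have "\<dots> = y h u"
        using sum.lessThan_Suc_shift[of "\<lambda>j. (\<tau> ^^ j) h *v u" m]
          sum.lessThan_Suc[of "\<lambda>j. (\<tau> ^^ j) h *v u" m]
        by (simp add: y_def m(1) del: funpow.simps)
      finally show ?thesis .
    qed
    then have "A = mat 1"
      using that by (intro matrix_eq_on_spanning[of "(\<lambda>h. y h u) ` H"]) (auto simp: U_def)
    then show ?thesis using A[OF \<open>h \<in> H\<close>] by (simp add: matrix_vector_mult_diff_rdistrib)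
  qed
  \<comment> \<open>A nonempty open set spans, so the vanishing of \<open>\<tau> h - h\<close> on
    \<open>U\<close> suffices.\<close>
  moreover have "span U = UNIV"
    using affine_hull_open[OF \<open>open U\<close>] \<open>v \<in> U\<close> affine_hull_subset_span[of U] by blast
  ultimately have "\<tau> h - h = 0"
    by (intro matrix_eq_on_spanning[of U]) auto
  then show ?thesis by simp
qed


section \<open>Affine symmetry groups\<close>

lemma AGL_iff:
  fixes P :: "(real ^ 'n) set"
  shows "A \<in> AGL P \<longleftrightarrow> invertible A \<and> (*v) A ` P = P"
proof -
  have "restrict ((*v) A) P \<in> affine_symmetries P \<longleftrightarrow> (*v) A ` P = P" if "invertible A"
  proof -
    have "inj ((*v) A)"
      using that by (metis invertible_left_inverse matrix_left_invertible_injective)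
    then have "inj_on ((*v) A) P" by (rule inj_on_subset) simp
    moreover have "\<exists>(B :: real ^ 'n ^ 'n) b. \<forall>x\<in>P. restrict ((*v) A) P x = B *v x + b"
      by (intro exI[of _ A] exI[of _ 0]) simp
    ultimately show ?thesis
      by (auto simp: affine_symmetries_def Bij_def bij_betw_def)
  qed
  then show ?thesis by (auto simp: AGL_def GL_def)
qed

lemma subgroup_AGL:
  fixes P :: "(real ^ 'n) set"
  shows "subgroup (AGL P) GL"
proof (rule group.subgroupI[OF group_GL])
  show "AGL P \<subseteq> carrier GL" by (auto simp: AGL_def)
  have "mat 1 \<in> AGL P" by (simp add: AGL_iff invertible_def[of "mat 1"])
  then show "AGL P \<noteq> {}" by auto
next
  fix A assume A: "A \<in> AGL P"
  define B where "B = inv\<^bsub>GL\<^esub> A"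
  have "A \<in> carrier GL" using A by (auto simp: AGL_def)
  then have B: "B \<in> carrier GL" "B ** A = mat 1"
    using group.inv_closed[OF group_GL] group.l_inv[OF group_GL] by (auto simp: B_def GL_def)
  have im: "(*v) A ` P = P" using A by (simp add: AGL_iff)
  have "(*v) B ` (*v) A ` P = P"
    by (simp add: image_image matrix_vector_mul_assoc B(2))
  then have "(*v) B ` P = P" by (simp only: im)
  then have "B \<in> AGL P" using B(1) by (simp add: AGL_iff GL_def)
  then show "inv\<^bsub>GL\<^esub> A \<in> AGL P" by (simp only: B_def)
next
  fix A B assume AB: "A \<in> AGL P" "B \<in> AGL P"
  have "(*v) (A ** B) ` P = (*v) A ` (*v) B ` P"
    by (simp add: image_image matrix_vector_mul_assoc)
  also have "\<dots> = P" using AB by (simp add: AGL_iff)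
  finally show "A \<otimes>\<^bsub>GL\<^esub> B \<in> AGL P"
    using AB by (simp add: AGL_iff GL_def invertible_mult)
qed

lemma AGL_extreme_points:
  fixes P :: "(real ^ 'n) set"
  assumes "A \<in> AGL P"
  shows "(*v) A ` {x. x extreme_point_of P} = {x. x extreme_point_of P}"
proof -
  have "inj ((*v) A)"
    using assms by (metis AGL_iff invertible_left_inverse matrix_left_invertible_injective)
  from extreme_points_of_linear_image[OF matrix_vector_mul_linear this, of P] assms
  show ?thesis by (simp add: AGL_iff)
qed

text \<open>The vertices span, so a linear symmetry is determined by its action on them, and a
  finite vertex set has only finitely many self-maps.\<close>

lemma finite_AGL:
  fixes V :: "(real ^ 'n) set"
  assumes "finite V" "span V = UNIV"
  shows "finite (AGL (convex hull V))"
proof -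
  define E where "E = {x. x extreme_point_of (convex hull V)}"
  have finE: "finite E"
    using finite_subset[OF extreme_points_of_convex_hull assms(1)] by (simp add: E_def)
  have "convex hull V = convex hull E"
    unfolding E_def by (rule Krein_Milman_polytope[OF assms(1)])
  then have "V \<subseteq> span E"
    using hull_subset[of V convex] convex_hull_subset_span[of E] by blast
  then have spanE: "span E = UNIV"
    using assms(2) span_minimal[OF _ subspace_span] by blast
  have "inj_on (\<lambda>A. restrict ((*v) A) E) (AGL (convex hull V))"
  proof (rule inj_onI)
    fix A B :: "real ^ 'n ^ 'n"
    assume "restrict ((*v) A) E = restrict ((*v) B) E"
    then have "A *v x = B *v x" if "x \<in> E" for x using that by (metis restrict_apply')
    then show "A = B" by (rule matrix_eq_on_spanning[OF spanE])
  qed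
  moreover have "(\<lambda>A. restrict ((*v) A) E) ` AGL (convex hull V) \<subseteq> E \<rightarrow>\<^sub>E E"
    using AGL_extreme_points[of _ "convex hull V"] by (fastforce simp: E_def[symmetric])
  ultimately show ?thesis
    using finite_PiE[OF finE, of "\<lambda>_. E"] finE by (meson finite_imageD finite_subset)
qed

section \<open>Vertices of orbit polytopes and the permutations induced on the group\<close>

lemma full_dim_orbit_polytope_span:
  "full_dim_orbit_polytope H u \<Longrightarrow> span ((\<lambda>h. h *v u) ` H) = UNIV"
  using affine_hull_subset_span by (auto simp: full_dim_orbit_polytope_def)

text \<open>Some orbit point is a vertex by Krein-Milman. The group acts transitively on the orbit
  by symmetries of the polytope, and these preserve vertices.\<close>

lemma extreme_points_orbit_polytope:
  assumes "finite H" "subgroup H GL" "full_dim_orbit_polytope H w"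
  shows "{x. x extreme_point_of orbit_polytope H w} = (\<lambda>h. h *v w) ` H"
proof
  show sub: "{x. x extreme_point_of orbit_polytope H w} \<subseteq> (\<lambda>h. h *v w) ` H"
    unfolding orbit_polytope_def by (rule extreme_points_of_convex_hull)
  have "orbit_polytope H w \<noteq> {}"
    using one_mem_G[OF assms] by (auto simp: orbit_polytope_def)
  then obtain x where x: "x extreme_point_of orbit_polytope H w"
    using Krein_Milman_polytope[of "(\<lambda>h. h *v w) ` H"] assms(1)
    by (force simp: orbit_polytope_def)
  then obtain k where k: "k \<in> H" "x = k *v w" using sub by auto
  show "(\<lambda>h. h *v w) ` H \<subseteq> {x. x extreme_point_of orbit_polytope H w}"
  proof
    fix y assume "y \<in> (\<lambda>h. h *v w) ` H"
    then obtain h where h: "h \<in> H" "y = h *v w" by auto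
    obtain g where g: "g \<in> H" "h = g ** k"
      using G_image_right(1)[OF assms k(1)] h(1) by blast
    have "invertible g" using subgroup.subset[OF assms(2)] g(1) by (auto simp: GL_def)
    then have "g \<in> AGL (orbit_polytope H w)"
      using orbit_polytope_image[OF assms g(1)] by (simp add: AGL_iff)
    from AGL_extreme_points[OF this] x have "g *v x \<in> {x. x extreme_point_of orbit_polytope H w}"
      by blast
    then show "y \<in> {x. x extreme_point_of orbit_polytope H w}"
      by (simp add: h g k matrix_vector_mul_assoc)
  qed
qed

lemma trivial_stabilizer_inj_on:
  assumes "subgroup H GL" "{h \<in> H. h *v w = w} = {mat 1}"
  shows "inj_on (\<lambda>h. h *v w) H"
proof (rule inj_onI)
  fix g h assume gh: "g \<in> H" "h \<in> H" "g *v w = h *v w"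
  let ?k = "inv\<^bsub>GL\<^esub> g"
  have g: "g \<in> carrier GL" using gh subgroup.subset[OF assms(1)] by auto
  have k: "?k ** g = mat 1" "g ** ?k = mat 1"
    using group.l_inv[OF group_GL g] group.r_inv[OF group_GL g] by (auto simp: GL_def)
  have "?k ** h \<in> H"
    using subgroup.m_closed[OF assms(1) subgroup.m_inv_closed[OF assms(1) gh(1)] gh(2)]
    by (simp add: GL_def)
  moreover have "(?k ** h) *v w = w"
    by (metis gh(3) k(1) matrix_vector_mul_assoc matrix_vector_mul_lid)
  ultimately have "?k ** h = mat 1" using assms(2) by blast
  then show "g = h" by (metis k(2) matrix_mul_assoc matrix_mul_lid matrix_mul_rid)
qed

text \<open>The vertices are exactly the orbit points, which \<open>inj\<close> labels by the
  elements of \<open>H\<close>, so the action of \<open>A\<close> on vertices transports to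
  \<open>H\<close>.\<close>

lemma AGL_orbit_polytope_induces:
  assumes H: "finite H" "subgroup H GL" "full_dim_orbit_polytope H w"
    and inj: "inj_on (\<lambda>h. h *v w) H"
    and A: "A \<in> AGL (orbit_polytope H w)"
  obtains \<sigma> where "\<sigma> \<in> LinSym H (\<lambda>h. h *v w)" "\<And>h. h \<in> H \<Longrightarrow> A *v (h *v w) = \<sigma> h *v w"
proof -
  let ?o = "\<lambda>h. h *v w"
  have inv: "invertible A" using A by (simp add: AGL_iff)
  have im: "(*v) A ` ?o ` H = ?o ` H"
    using AGL_extreme_points[OF A] by (simp add: extreme_points_orbit_polytope[OF H])
  \<comment> \<open>Outside \<open>H\<close> the value is \<open>h\<close> itself, as
    \<open>permutes\<close> demands.\<close>
  define \<sigma> where "\<sigma> h = (if h \<in> H then inv_into H ?o (A *v ?o h) else h)" for h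
  have \<sigma>: "\<sigma> h \<in> H" "?o (\<sigma> h) = A *v ?o h" if "h \<in> H" for h
  proof -
    have "A *v ?o h \<in> ?o ` H" using im that by blast
    from inv_into_into[OF this] f_inv_into_f[OF this]
    show "\<sigma> h \<in> H" "?o (\<sigma> h) = A *v ?o h"
      using that by (simp_all add: \<sigma>_def)
  qed
  have "inj ((*v) A)"
    using inv by (metis invertible_left_inverse matrix_left_invertible_injective)
  then have "inj_on \<sigma> H"
    using \<sigma>(2) inj by (intro inj_onI) (metis inj_onD injD)
  then have "bij_betw \<sigma> H H"
    using endo_inj_surj[OF H(1)] \<sigma>(1) by (auto simp: bij_betw_def)
  then have "\<sigma> permutes H" by (rule bij_imp_permutes) (simp add: \<sigma>_def)
  then have "\<sigma> \<in> LinSym H ?o"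
    using \<sigma>(2) inv by (auto simp: LinSym_def GL_def intro!: bexI[of _ A])
  then show thesis using \<sigma>(2) by (intro that) auto
qed

section \<open>The affine symmetry group of a generic orbit polytope\<close>

theorem theorem2:
  fixes G :: "(real ^ 'n ^ 'n) set" and v w :: "real ^ 'n"
  assumes "subgroup G GL"
    and "finite G"
    and "full_dim_orbit_polytope G v"
    and "generic_for (AGL (orbit_polytope G v)) w"
  shows "AGL (orbit_polytope (AGL (orbit_polytope G v)) w) = AGL (orbit_polytope G v)"
proof -
  define P where "P = orbit_polytope G v"
  define H where "H = AGL P"
  note G = assms(2,1,3)
  have finH: "finite H"
    unfolding H_def P_def orbit_polytope_def
    using G(1) full_dim_orbit_polytope_span[OF G(3)] by (intro finite_AGL) auto
  have subH: "subgroup H GL" unfolding H_def by (rule subgroup_AGL)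
  have GH: "G \<subseteq> H"
    using subgroup.subset[OF G(2)] orbit_polytope_image[OF G]
    by (auto simp: H_def P_def AGL_iff GL_def)
  have gen: "full_dim_orbit_polytope H w" "{h \<in> H. h *v w = w} = {mat 1}"
      "LinSym H (\<lambda>h. map_matrix ratfun_const h *v ratfun_X) = LinSym H (\<lambda>h. h *v w)"
    using assms(4) by (auto simp: generic_for_def H_def P_def)
  note H = finH subH gen(1)
  let ?Hv = "(\<lambda>h. h *v v) ` H"
  have span_v: "span ?Hv = UNIV"
    using span_mono[OF image_mono[OF GH]] full_dim_orbit_polytope_span[OF G(3)] by blast
  \<comment> \<open>\<open>H\<close> contains \<open>G\<close> and preserves \<open>P\<close>, so
    the original polytope is also the orbit polytope of \<open>H\<close> at
    \<open>v\<close>.\<close>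
  have P_eq: "P = convex hull ?Hv"
  proof
    show "P \<subseteq> convex hull ?Hv"
      unfolding P_def orbit_polytope_def by (intro hull_mono image_mono GH)
    have "v \<in> (\<lambda>g. g *v v) ` G"
      using one_mem_G[OF G] by (intro image_eqI[of _ _ "mat 1"]) simp_all
    then have "v \<in> P" by (simp add: P_def orbit_polytope_def hull_inc)
    then have "?Hv \<subseteq> P" unfolding H_def using AGL_iff[of _ P] by blast
    moreover have "convex P" by (simp add: P_def orbit_polytope_def)
    ultimately show "convex hull ?Hv \<subseteq> P" by (rule hull_minimal)
  qed
  have "A \<in> H" if A_sym: "A \<in> AGL (orbit_polytope H w)" for A
  proof -
    obtain \<sigma> where "\<sigma> \<in> LinSym H (\<lambda>h. h *v w)"
      and A: "\<And>h. h \<in> H \<Longrightarrow> A *v (h *v w) = \<sigma> h *v w"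
      using AGL_orbit_polytope_induces[OF H trivial_stabilizer_inj_on[OF subH gen(2)] A_sym] by metis
    then have \<sigma>: "\<sigma> \<in> LinSym H (\<lambda>h. map_matrix ratfun_const h *v ratfun_X)"
      using gen(3) by simp
    then have perm: "\<sigma> permutes H" by (simp add: LinSym_def)
    \<comment> \<open>Genericity of \<open>w\<close> is what carries \<sigma> from the orbit of
      \<open>w\<close> to every spanning orbit of \<open>H\<close>.\<close>
    note spec = ratfun_LinSym_specialise[OF finH \<sigma>]
    \<comment> \<open>Specialised at \<open>v\<close>, the matrix permutes the points
      \<open>h *v v\<close>; it therefore preserves their convex hull \<open>P\<close> and belongs
      to \<open>H\<close>.\<close>
    obtain k where k: "invertible k" "\<And>h. h \<in> H \<Longrightarrow> k *v (h *v v) = \<sigma> h *v v"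
      using spec[OF span_v] by (auto simp: LinSym_def GL_def)
    have "(*v) k ` ?Hv = (\<lambda>h. h *v v) ` \<sigma> ` H" using k(2) by (auto simp: image_image)
    then have "(*v) k ` P = P"
      by (simp add: P_eq convex_hull_linear_image permutes_image[OF perm])
    then have kH: "k \<in> H" using k(1) by (simp add: H_def AGL_iff)
    define l where "l = inv\<^bsub>GL\<^esub> k"
    have lH: "l \<in> H" unfolding l_def by (rule subgroup.m_inv_closed[OF subH kH])
    have kc: "k \<in> carrier GL" using k(1) by (simp add: GL_def)
    have lk: "l ** k = mat 1" "k ** l = mat 1"
      using group.l_inv[OF group_GL kc] group.r_inv[OF group_GL kc] by (auto simp: l_def GL_def)
    have l_cancel: "l *v (k *v x) = x" for x by (simp add: matrix_vector_mul_assoc lk)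
    \<comment> \<open>Correcting \<sigma> by the inverse of \<open>k\<close> gives a permutation
      that no longer moves the points \<open>h *v v\<close>, as the rigidity lemma requires.\<close>
    define \<tau> where "\<tau> h = (if h \<in> H then l ** \<sigma> h else h)" for h
    have \<tau>: "\<tau> h *v u = l *v (\<sigma> h *v u)" if "h \<in> H" for h u
      using that by (simp add: \<tau>_def matrix_vector_mul_assoc)
    have "inj_on ((**) l) H"
      by (intro inj_onI) (metis lk(2) matrix_mul_assoc matrix_mul_lid)
    then have "bij_betw ((**) l) H H"
      using G_image_left[OF H lH] by (simp add: bij_betw_def)
    from bij_betw_trans[OF permutes_imp_bij[OF perm] this] have "bij_betw \<tau> H H"
      by (rule bij_betw_cong[THEN iffD1, rotated]) (simp add: \<tau>_def)
    then have perm': "\<tau> permutes H" by (rule bij_imp_permutes) (simp add: \<tau>_def)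
    have "\<tau> h = h" if "h \<in> H" for h
    proof (rule LinSym_rigid[OF finH perm' span_v _ _ that])
      show "\<tau> h *v v = h *v v" if "h \<in> H" for h
        using k(2)[OF that] l_cancel[of "h *v v"] by (simp add: \<tau>[OF that])
    next
      fix u assume "span ((\<lambda>h. h *v u) ` H) = UNIV"
      from spec[OF this] obtain B where "\<And>h. h \<in> H \<Longrightarrow> B *v (h *v u) = \<sigma> h *v u"
        by (auto simp: LinSym_def)
      then have "\<forall>h\<in>H. (l ** B) *v (h *v u) = \<tau> h *v u"
        by (simp add: \<tau> flip: matrix_vector_mul_assoc)
      then show "\<exists>B. \<forall>h\<in>H. B *v (h *v u) = \<tau> h *v u" by blast
    qed
    then have "l ** \<sigma> h = h" if "h \<in> H" for h using that by (simp add: \<tau>_def)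
    then have "\<sigma> h = k ** h" if "h \<in> H" for h
      using that by (metis lk(2) matrix_mul_assoc matrix_mul_lid)
    \<comment> \<open>Both matrices send \<open>h *v w\<close> to \<open>\<sigma> h *v w\<close>,
      and this orbit spans.\<close>
    then have "A = k"
      using A full_dim_orbit_polytope_span[OF gen(1)]
      by (intro matrix_eq_on_spanning[of "(\<lambda>h. h *v w) ` H"])
        (auto simp flip: matrix_vector_mul_assoc)
    then show "A \<in> H" using kH by simp
  qed
  \<comment> \<open>The reverse inclusion: \<open>H\<close> acts by symmetries on its own orbit
    polytope.\<close>
  moreover have "A \<in> AGL (orbit_polytope H w)" if "A \<in> H" for A
    using orbit_polytope_image[OF H that] that by (simp add: H_def AGL_iff)
  ultimately show ?thesis by (auto simp: H_def P_def)
qed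

end
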